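(* Let $K$ be a field of characteristic $0$, let $X$ be a set, and let $\mathcal{A}s_1\langle X\rangle$ be the free first-type associative algebra generated by $X$. Let $\mathcal{A}s_1^{(+)}\langle X\rangle$ be the same vector space with the anti-commutator operation $\{a,b\}=ab+ba$. Then $\mathcal{A}s_1^{(+)}\langle X\rangle$ satisfies the following identity of degree $5$ (for all elements $a,b,c,d,e$): $$\{\{\{\{a,b\},c\},d\},e\}+\{\{\{\{a,b\},d\},c\},e\}=0.$$
   Context: A first-type associative algebra is an associative (not necessarily unital) $K$-algebra satisfying the identity $abc+bac+acb+cab+bca+cba=0$; $\mathcal{A}s_1$ is the variety of all such algebras and $\mathcal{A}s_1\langle X\rangle$ is the free algebra of this variety on $X$. *)

theory Defs
  imports "HOL-Algebra.QuotRing" "HOL-Algebra.Module" "HOL-Library.Poly_Mapping"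
begin

section \<open>Associative algebras that need not be unital\<close>

text \<open>
  The \<open>module\<close> record of HOL-Algebra extends the \<open>ring\<close> record and hence has a field \<open>one\<close>.
  Nothing below constrains or uses that field. Scalars come from a type of class \<open>field\<close>.
\<close>

locale nonunital_algebra = abelian_group A for A :: "('k::field, 'a) module" (structure) +
  assumes m_closed [simp, intro]: "\<lbrakk>x \<in> carrier A; y \<in> carrier A\<rbrakk> \<Longrightarrow> x \<otimes> y \<in> carrier A"
    and m_assoc: "\<lbrakk>x \<in> carrier A; y \<in> carrier A; z \<in> carrier A\<rbrakk> \<Longrightarrow> (x \<otimes> y) \<otimes> z = x \<otimes> (y \<otimes> z)"
    and l_distr: "\<lbrakk>x \<in> carrier A; y \<in> carrier A; z \<in> carrier A\<rbrakk> \<Longrightarrow> (x \<oplus> y) \<otimes> z = x \<otimes> z \<oplus> y \<otimes> z"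
    and r_distr: "\<lbrakk>x \<in> carrier A; y \<in> carrier A; z \<in> carrier A\<rbrakk> \<Longrightarrow> z \<otimes> (x \<oplus> y) = z \<otimes> x \<oplus> z \<otimes> y"
    and smult_closed [simp, intro]: "x \<in> carrier A \<Longrightarrow> s \<odot> x \<in> carrier A"
    and smult_l_distr: "x \<in> carrier A \<Longrightarrow> (s + t) \<odot> x = s \<odot> x \<oplus> t \<odot> x"
    and smult_r_distr: "\<lbrakk>x \<in> carrier A; y \<in> carrier A\<rbrakk> \<Longrightarrow> s \<odot> (x \<oplus> y) = s \<odot> x \<oplus> s \<odot> y"
    and smult_assoc1: "x \<in> carrier A \<Longrightarrow> (s * t) \<odot> x = s \<odot> (t \<odot> x)"
    and smult_one [simp]: "x \<in> carrier A \<Longrightarrow> 1 \<odot> x = x"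
    and smult_assoc2: "\<lbrakk>x \<in> carrier A; y \<in> carrier A\<rbrakk> \<Longrightarrow> (s \<odot> x) \<otimes> y = s \<odot> (x \<otimes> y)"
    and smult_assoc3: "\<lbrakk>x \<in> carrier A; y \<in> carrier A\<rbrakk> \<Longrightarrow> x \<otimes> (s \<odot> y) = s \<odot> (x \<otimes> y)"

definition first_type_poly :: "('k, 'a) module \<Rightarrow> 'a \<Rightarrow> 'a \<Rightarrow> 'a \<Rightarrow> 'a" where
  "first_type_poly A a b c =
     a \<otimes>\<^bsub>A\<^esub> b \<otimes>\<^bsub>A\<^esub> c \<oplus>\<^bsub>A\<^esub> b \<otimes>\<^bsub>A\<^esub> a \<otimes>\<^bsub>A\<^esub> c \<oplus>\<^bsub>A\<^esub> a \<otimes>\<^bsub>A\<^esub> c \<otimes>\<^bsub>A\<^esub> b \<oplus>\<^bsub>A\<^esub>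
     c \<otimes>\<^bsub>A\<^esub> a \<otimes>\<^bsub>A\<^esub> b \<oplus>\<^bsub>A\<^esub> b \<otimes>\<^bsub>A\<^esub> c \<otimes>\<^bsub>A\<^esub> a \<oplus>\<^bsub>A\<^esub> c \<otimes>\<^bsub>A\<^esub> b \<otimes>\<^bsub>A\<^esub> a"

locale first_type_algebra = nonunital_algebra +
  assumes first_type: "\<lbrakk>a \<in> carrier A; b \<in> carrier A; c \<in> carrier A\<rbrakk> \<Longrightarrow> first_type_poly A a b c = \<zero>"

definition algebra_hom :: "('k, 'a) module \<Rightarrow> ('k, 'b) module \<Rightarrow> ('a \<Rightarrow> 'b) set" where
  "algebra_hom A B = {h \<in> carrier A \<rightarrow> carrier B.
     (\<forall>x\<in>carrier A. \<forall>y\<in>carrier A. h (x \<oplus>\<^bsub>A\<^esub> y) = h x \<oplus>\<^bsub>B\<^esub> h y \<and> h (x \<otimes>\<^bsub>A\<^esub> y) = h x \<otimes>\<^bsub>B\<^esub> h y) \<and>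
     (\<forall>s. \<forall>x\<in>carrier A. h (s \<odot>\<^bsub>A\<^esub> x) = s \<odot>\<^bsub>B\<^esub> h x)}"

definition plus_algebra :: "('k, 'a) module \<Rightarrow> ('k, 'a) module" where
  "plus_algebra A = A\<lparr>mult := (\<lambda>a b. a \<otimes>\<^bsub>A\<^esub> b \<oplus>\<^bsub>A\<^esub> b \<otimes>\<^bsub>A\<^esub> a)\<rparr>"

section \<open>Ideals and quotients\<close>

locale algebra_ideal = nonunital_algebra + additive_subgroup I A for I +
  assumes I_l_closed: "\<lbrakk>i \<in> I; x \<in> carrier A\<rbrakk> \<Longrightarrow> x \<otimes> i \<in> I"
    and I_r_closed: "\<lbrakk>i \<in> I; x \<in> carrier A\<rbrakk> \<Longrightarrow> i \<otimes> x \<in> I"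
    and I_smult_closed: "i \<in> I \<Longrightarrow> s \<odot> i \<in> I"

definition algebra_genideal :: "('k::field, 'a) module \<Rightarrow> 'a set \<Rightarrow> 'a set" where
  "algebra_genideal A S = \<Inter>{I. algebra_ideal A I \<and> S \<subseteq> I}"

definition algebra_quot :: "('k, 'a) module \<Rightarrow> 'a set \<Rightarrow> ('k, 'a set) module" where
  "algebra_quot A I =
     ring.extend (A Quot I) \<lparr>smult = (\<lambda>s C. \<Union>a\<in>C. I +>\<^bsub>A\<^esub> (s \<odot>\<^bsub>A\<^esub> a))\<rparr>"

section \<open>The free associative algebra without unit\<close>

datatype 'x word = Word (letters: "'x list")

instantiation word :: (type) monoid_add
begin
definition "0 = Word []"
definition "u + v = Word (letters u @ letters v)"
instance by standard (simp_all add: zero_word_def plus_word_def)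
end

text \<open>
  With concatenation as addition of words, multiplication in \<open>'x word \<Rightarrow>\<^sub>0 'k\<close> is the product of
  noncommutative polynomials. Omitting the empty word gives the algebra without unit.
\<close>

definition free_assoc :: "'x set \<Rightarrow> ('k::field, 'x word \<Rightarrow>\<^sub>0 'k) module" where
  "free_assoc X =
     \<lparr>carrier = {p. \<forall>w \<in> Poly_Mapping.keys p. w \<noteq> 0 \<and> set (letters w) \<subseteq> X},
      mult = (*), one = undefined, zero = 0, add = (+),
      smult = (\<lambda>s. Poly_Mapping.map ((*) s))\<rparr>"

text \<open>
  The generators below range over all substitution instances of the identity, so the ideal they
  generate is the T-ideal of the variety.
\<close>

definition first_type_ideal :: "'x set \<Rightarrow> ('x word \<Rightarrow>\<^sub>0 'k::field) set" where
  "first_type_ideal X = algebra_genideal (free_assoc X)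
     {first_type_poly (free_assoc X) a b c | a b c.
        a \<in> carrier (free_assoc X) \<and> b \<in> carrier (free_assoc X) \<and> c \<in> carrier (free_assoc X)}"

definition free_first_type :: "'x set \<Rightarrow> ('k::field, ('x word \<Rightarrow>\<^sub>0 'k) set) module" where
  "free_first_type X = algebra_quot (free_assoc X) (first_type_ideal X)"

definition free_first_type_gen :: "'x set \<Rightarrow> 'x \<Rightarrow> ('x word \<Rightarrow>\<^sub>0 'k::field) set" where
  "free_first_type_gen X x =
     first_type_ideal X +>\<^bsub>free_assoc X :: ('k, _) module\<^esub> Poly_Mapping.single (Word [x]) 1"

section \<open>Adequacy of the construction\<close>

subsection \<open>The quotient algebra\<close>

lemma algebra_quot_simps [simp]:
  "carrier (algebra_quot A I) = a_rcosets\<^bsub>A\<^esub> I"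
  "mult (algebra_quot A I) = rcoset_mult A I"
  "zero (algebra_quot A I) = I"
  "add (algebra_quot A I) = set_add A"
  "smult (algebra_quot A I) = (\<lambda>s C. \<Union>a\<in>C. I +>\<^bsub>A\<^esub> (s \<odot>\<^bsub>A\<^esub> a))"
  by (simp_all add: algebra_quot_def FactRing_def ring.extend_def)

context nonunital_algebra
begin

lemma smult_null [simp]: "x \<in> carrier A \<Longrightarrow> 0 \<odot> x = \<zero>"
  using smult_l_distr[of x 0 0] add.l_cancel_one' smult_closed by auto

lemma smult_zero [simp]: "s \<odot> \<zero> = \<zero>"
  using smult_r_distr[of \<zero> \<zero> s] add.l_cancel_one' by auto

lemma smult_minus1: "x \<in> carrier A \<Longrightarrow> (-1) \<odot> x = \<ominus> x"
  using smult_l_distr[of x "-1" 1] by (simp add: minus_equality)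

lemma l_null [simp]: "x \<in> carrier A \<Longrightarrow> \<zero> \<otimes> x = \<zero>"
  using l_distr[of \<zero> \<zero> x] add.l_cancel_one' by auto

lemma r_null [simp]: "x \<in> carrier A \<Longrightarrow> x \<otimes> \<zero> = \<zero>"
  using r_distr[of \<zero> \<zero> x] add.l_cancel_one' by auto

end

context algebra_ideal
begin

sublocale abelian_subgroup I A
  by (rule abelian_subgroupI3) (unfold_locales)

lemma coset_eqI: 
  assumes "i \<in> I" "x \<in> carrier A" "y = i \<oplus> x" shows "I +> y = I +> x"
proof -
  have "y \<in> I +> x" using assms by (auto simp: a_r_coset_def r_coset_def)
  then show ?thesis using a_repr_independence[of y I x] assms a_subgroup by blast
qed

lemma coset_elem: "y \<in> I +> x \<longleftrightarrow> (\<exists>i\<in>I. y = i \<oplus> x)"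
  by (auto simp: a_r_coset_def r_coset_def)

lemma quot_mult:
  assumes x: "x \<in> carrier A" and y: "y \<in> carrier A"
  shows "rcoset_mult A I (I +> x) (I +> y) = I +> (x \<otimes> y)"
proof -
  have "I +> (a \<otimes> b) = I +> (x \<otimes> y)" if a: "a \<in> I +> x" and b: "b \<in> I +> y" for a b
  proof -
    obtain i j where i: "i \<in> I" "a = i \<oplus> x" and j: "j \<in> I" "b = j \<oplus> y"
      using a b coset_elem by auto
    note [simp] = a_Hcarr[OF i(1)] a_Hcarr[OF j(1)] 
    have "a \<otimes> b = (i \<otimes> j \<oplus> i \<otimes> y \<oplus> x \<otimes> j) \<oplus> x \<otimes> y"
      using i j x y by (simp add: l_distr r_distr a_ac)
    moreover have "i \<otimes> j \<oplus> i \<otimes> y \<oplus> x \<otimes> j \<in> I"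
      using i j x y by (intro a_closed I_l_closed I_r_closed) auto
    ultimately show ?thesis using x y by (intro coset_eqI) auto
  qed
  moreover have "x \<in> I +> x" "y \<in> I +> y" using x y a_rcos_self by auto
  ultimately show ?thesis unfolding rcoset_mult_def by blast
qed

lemma quot_smult:
  assumes x: "x \<in> carrier A"
  shows "(\<Union>a\<in>I +> x. I +> (s \<odot> a)) = I +> (s \<odot> x)"
proof -
  have "I +> (s \<odot> a) = I +> (s \<odot> x)" if a: "a \<in> I +> x" for a
  proof -
    obtain i where i: "i \<in> I" "a = i \<oplus> x" using a coset_elem by auto
    then show ?thesis using x a_Hcarr[OF i(1)] I_smult_closed[OF i(1)]
      by (intro coset_eqI) (auto simp: smult_r_distr)
  qed
  moreover have "x \<in> I +> x" using x a_rcos_self by auto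
  ultimately show ?thesis by blast
qed

lemma quot_carrierE:
  assumes "C \<in> a_rcosets I" obtains x where "x \<in> carrier A" "C = I +> x"
  using assms by (auto simp: A_RCOSETS_def')

lemma quot_carrierI: "x \<in> carrier A \<Longrightarrow> I +> x \<in> a_rcosets I"
  by (auto simp: A_RCOSETS_def')

lemma coset_I: "I +> \<zero> = I"
  by (rule a_coset_add_zero) (rule a_subset)

lemma coset_eq_I: "x \<in> I \<Longrightarrow> I +> x = I"
  using coset_eqI[of x \<zero> x] coset_I by simp

lemma quot_abelian_group: "abelian_group (algebra_quot A I)"
proof (rule abelian_groupI, simp_all, goal_cases)
  case (1 x y) then show ?case by (elim quot_carrierE) (simp only: a_rcos_sum quot_carrierI add.m_closed)
next
  case 2 then show ?case using quot_carrierI[OF a_Hcarr[OF zero_closed]] by (simp only: coset_I)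
next
  case (3 x y z) then show ?case
    by (elim quot_carrierE) (simp add: a_rcos_sum a_assoc)
next
  case (4 x y) then show ?case
    by (elim quot_carrierE) (simp add: a_rcos_sum a_comm)
next
  case (5 x) then show ?case
    using a_rcos_sum[OF a_Hcarr[OF zero_closed]] by (elim quot_carrierE) (simp only: coset_I l_zero)
next
  case (6 x) 
  then obtain u where u: "u \<in> carrier A" "x = I +> u" by (elim quot_carrierE)
  then have "(I +> (\<ominus> u)) <+> x = I" by (simp add: a_rcos_sum l_neg coset_I)
  then show ?case using quot_carrierI[of "\<ominus> u"] u by auto
qed

lemma quot_nonunital_algebra: "nonunital_algebra (algebra_quot A I)"
proof (intro nonunital_algebra.intro nonunital_algebra_axioms.intro quot_abelian_group, unfold algebra_quot_simps, goal_cases)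
  case (1 x y) then show ?case by (auto elim!: quot_carrierE simp: quot_mult quot_carrierI)
next
  case (2 x y z) then show ?case by (elim quot_carrierE) (simp add: quot_mult m_assoc)
next
  case (3 x y z) then show ?case by (elim quot_carrierE) (simp add: quot_mult a_rcos_sum l_distr)
next
  case (4 x y z) then show ?case by (elim quot_carrierE) (simp add: quot_mult a_rcos_sum r_distr)
next
  case (5 x s) then show ?case by (elim quot_carrierE) (simp only: quot_smult quot_carrierI smult_closed)
next
  case (6 x s t) then show ?case by (elim quot_carrierE) (simp only: quot_smult a_rcos_sum smult_closed smult_l_distr)
next
  case (7 x y s) then show ?case by (elim quot_carrierE) (simp only: quot_smult a_rcos_sum smult_closed add.m_closed smult_r_distr)
next
  case (8 x s t) then show ?case by (elim quot_carrierE) (simp only: quot_smult smult_closed smult_assoc1)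
next
  case (9 x) then show ?case by (elim quot_carrierE) (simp only: quot_smult smult_one)
next
  case (10 x y s) then show ?case by (elim quot_carrierE) (simp only: quot_smult quot_mult smult_closed m_closed smult_assoc2)
next
  case (11 x y s) then show ?case by (elim quot_carrierE) (simp only: quot_smult quot_mult smult_closed m_closed smult_assoc3)
qed

lemma quot_first_type_poly:
  assumes "a \<in> carrier A" "b \<in> carrier A" "c \<in> carrier A"
  shows "first_type_poly (algebra_quot A I) (I +> a) (I +> b) (I +> c) = I +> first_type_poly A a b c"
  using assms by (simp add: first_type_poly_def quot_mult a_rcos_sum)

end

lemma (in nonunital_algebra) first_type_poly_closed:
  "\<lbrakk>a \<in> carrier A; b \<in> carrier A; c \<in> carrier A\<rbrakk> \<Longrightarrow> first_type_poly A a b c \<in> carrier A"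
  by (simp add: first_type_poly_def)

lemma (in nonunital_algebra) additive_subgroup_smultI:
  assumes "I \<subseteq> carrier A" "\<zero> \<in> I" "\<And>x y. x \<in> I \<Longrightarrow> y \<in> I \<Longrightarrow> x \<oplus> y \<in> I"
    "\<And>s x. x \<in> I \<Longrightarrow> s \<odot> x \<in> I"
  shows "additive_subgroup I A"
proof (rule additive_subgroupI, unfold_locales)
  show "I \<subseteq> carrier (add_monoid A)" using assms by simp
  show "inv\<^bsub>add_monoid A\<^esub> x \<in> I" if "x \<in> I" for x
    using assms(1) assms(4)[OF that, of "-1"] smult_minus1[of x] that by (auto simp: a_inv_def)
qed (use assms in auto)

lemma (in nonunital_algebra) algebra_ideal_carrier: "algebra_ideal A (carrier A)"
  by (intro algebra_ideal.intro algebra_ideal_axioms.intro additive_subgroup_smultI nonunital_algebra_axioms) auto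

lemma (in nonunital_algebra) algebra_genideal_ideal:
  assumes "S \<subseteq> carrier A"
  shows "algebra_ideal A (algebra_genideal A S)"
proof -
  have sub: "algebra_genideal A S \<subseteq> carrier A"
    using assms algebra_ideal_carrier by (auto simp: algebra_genideal_def)
  have ideal: "additive_subgroup I A" if "algebra_ideal A I" for I
    using that by (rule algebra_ideal.axioms)
  show ?thesis
  proof (intro algebra_ideal.intro algebra_ideal_axioms.intro additive_subgroup_smultI nonunital_algebra_axioms sub)
  qed (auto simp: algebra_genideal_def dest: algebra_ideal.I_l_closed algebra_ideal.I_r_closed algebra_ideal.I_smult_closed additive_subgroup.zero_closed[OF ideal] additive_subgroup.a_closed[OF ideal])
qed

lemma algebra_genideal_minimal: "algebra_ideal A I \<Longrightarrow> S \<subseteq> I \<Longrightarrow> algebra_genideal A S \<subseteq> I"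
  by (auto simp: algebra_genideal_def)

lemma algebra_genideal_self: "S \<subseteq> algebra_genideal A S"
  by (auto simp: algebra_genideal_def)

subsection \<open>The free associative algebra\<close>

lemma poly_mapping_span_induct [consumes 1, case_names zero single add]:
  fixes p :: "'a \<Rightarrow>\<^sub>0 'b::ab_group_add"
  assumes "Poly_Mapping.keys p \<subseteq> S" and zero: "P 0" and single: "\<And>w c. w \<in> S \<Longrightarrow> P (Poly_Mapping.single w c)"
    and add: "\<And>p q. \<lbrakk>Poly_Mapping.keys p \<subseteq> S; Poly_Mapping.keys q \<subseteq> S; P p; P q\<rbrakk> \<Longrightarrow> P (p + q)"
  shows "P p"
  using assms(1)
proof (induction "card (Poly_Mapping.keys p)" arbitrary: p)
  case 0 then show ?case using zero by simp
next
  case (Suc n)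
  then obtain w where w: "w \<in> Poly_Mapping.keys p" by (metis all_not_in_conv card.empty nat.distinct(1))
  define q where "q = p - Poly_Mapping.single w (Poly_Mapping.lookup p w)"
  have keys_q: "Poly_Mapping.keys q = Poly_Mapping.keys p - {w}"
    by (auto simp: q_def in_keys_iff lookup_minus lookup_single when_def split: if_splits)
  then have "P q" using Suc w by (intro Suc.hyps) auto
  moreover have "p = Poly_Mapping.single w (Poly_Mapping.lookup p w) + q" by (simp add: q_def)
  moreover have "Poly_Mapping.keys q \<subseteq> S" "w \<in> S" using Suc.prems w keys_q by auto
  ultimately show ?case
    using add[of "Poly_Mapping.single w (Poly_Mapping.lookup p w)" q] single by simp
qed

lemma lookup_scale [simp]:
  "Poly_Mapping.lookup (Poly_Mapping.map ((*) s) p) w = s * (Poly_Mapping.lookup p w :: 'k::field)"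
  by (simp add: Poly_Mapping.map.rep_eq when_def)

lemma keys_scale_subset: "Poly_Mapping.keys (Poly_Mapping.map ((*) (s::'k::field)) p) \<subseteq> Poly_Mapping.keys p"
  by (auto simp: in_keys_iff)

lemma free_assoc_simps [simp]:
  "p \<in> carrier (free_assoc X) \<longleftrightarrow> (\<forall>w \<in> Poly_Mapping.keys p. w \<noteq> 0 \<and> set (letters w) \<subseteq> X)"
  "mult (free_assoc X) = (*)" "zero (free_assoc X) = 0" "add (free_assoc X) = (+)"
  "smult (free_assoc X) = (\<lambda>s. Poly_Mapping.map ((*) s))"
  by (simp_all add: free_assoc_def)

lemma free_assoc_nonunital_algebra: 
  "nonunital_algebra (free_assoc X :: ('k::field, _) module)"
proof -
  have grp: "abelian_group (free_assoc X :: ('k::field, _) module)"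
  proof (rule abelian_groupI, unfold free_assoc_simps, goal_cases)
    case (1 x y) then show ?case using keys_add[of x y] by blast
  next
    case 2 then show ?case by simp
  next
    case (3 x y z) show ?case by (rule add.assoc)
  next
    case (4 x y) show ?case by (rule add.commute)
  next
    case (5 x) show ?case by simp
  next
    case (6 x) then show ?case
      by (intro bexI[of _ "- x"]) (auto simp: in_keys_iff)
  qed
  show ?thesis
  proof (intro nonunital_algebra.intro nonunital_algebra_axioms.intro grp, unfold free_assoc_simps, goal_cases)
    case (1 x y)
    show ?case
    proof
      fix w assume "w \<in> Poly_Mapping.keys (x * y)"
      then obtain u v where uv: "u \<in> Poly_Mapping.keys x" "v \<in> Poly_Mapping.keys y" "w = u + v"
        using keys_mult[of x y] by auto
      then have "u \<noteq> 0" "set (letters u) \<subseteq> X" "set (letters v) \<subseteq> X" using 1 by auto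
      then show "w \<noteq> 0 \<and> set (letters w) \<subseteq> X"
        using uv(3) by (cases u) (simp add: plus_word_def zero_word_def)
    qed
  next
    case (2 x y z) show ?case by (rule mult.assoc)
  next
    case (3 x y z) show ?case by (rule distrib_right)
  next
    case (4 x y z) show ?case by (rule distrib_left)
  next
    case (5 x s) then show ?case using keys_scale_subset[of s x] by blast
  next
    case (6 x s t) show ?case by (rule poly_mapping_eqI) (simp add: lookup_add distrib_right)
  next
    case (7 x y s) show ?case by (rule poly_mapping_eqI) (simp add: lookup_add distrib_left)
  next
    case (8 x s t) show ?case by (rule poly_mapping_eqI) (simp add: mult.assoc)
  next
    case (9 x) show ?case by (rule poly_mapping_eqI) simp
  next
    case (10 x y s) show ?case by (simp add: mult_map_scale_conv_mult mult.assoc)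
  next
    case (11 x y s)
    have "Poly_Mapping.single 0 s * x = x * Poly_Mapping.single 0 s"
      by (rule poly_mapping_span_induct[of x UNIV])
        (simp_all add: mult_single mult.commute distrib_left distrib_right)
    then show ?case by (simp add: mult_map_scale_conv_mult flip: mult.assoc)
  qed
qed

interpretation free_assoc: nonunital_algebra "free_assoc X :: ('k::field, _) module" for X
  by (rule free_assoc_nonunital_algebra)

fun word_eval :: "('k, 'b) module \<Rightarrow> ('x \<Rightarrow> 'b) \<Rightarrow> 'x list \<Rightarrow> 'b" where
  "word_eval B f [] = \<zero>\<^bsub>B\<^esub>"
| "word_eval B f [x] = f x"
| "word_eval B f (x # y # ys) = f x \<otimes>\<^bsub>B\<^esub> word_eval B f (y # ys)"

definition free_assoc_lift ::
    "('k::field, 'b) module \<Rightarrow> ('x \<Rightarrow> 'b) \<Rightarrow> ('x word \<Rightarrow>\<^sub>0 'k) \<Rightarrow> 'b" where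
  "free_assoc_lift B f p =
     (\<Oplus>\<^bsub>B\<^esub>w\<in>Poly_Mapping.keys p. Poly_Mapping.lookup p w \<odot>\<^bsub>B\<^esub> word_eval B f (letters w))"

context nonunital_algebra
begin

lemma word_eval_closed: "f \<in> X \<rightarrow> carrier A \<Longrightarrow> set us \<subseteq> X \<Longrightarrow> word_eval A f us \<in> carrier A"
  by (induction us rule: induct_list012) auto

lemma word_eval_append:
  assumes "f \<in> X \<rightarrow> carrier A" "set us \<subseteq> X" "set vs \<subseteq> X" "us \<noteq> []" "vs \<noteq> []"
  shows "word_eval A f (us @ vs) = word_eval A f us \<otimes> word_eval A f vs"
  using assms(2,4)
proof (induction us rule: induct_list012)
  case (2 x) then show ?case using assms(5) by (cases vs) auto
next
  case (3 x y zs)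
  then show ?case using assms(1,3) word_eval_closed[of f X "y # zs"] word_eval_closed[of f X vs]
    by (auto simp: m_assoc Pi_iff)
qed simp

context
  fixes f :: "'x \<Rightarrow> 'a" and X
  assumes f: "f \<in> X \<rightarrow> carrier A"
begin

lemma free_assoc_lift_superset:
  assumes "finite S" "Poly_Mapping.keys p \<subseteq> S" "\<And>w. w \<in> S \<Longrightarrow> set (letters w) \<subseteq> X"
  shows "free_assoc_lift A f p = (\<Oplus>w\<in>S. Poly_Mapping.lookup p w \<odot> word_eval A f (letters w))"
  unfolding free_assoc_lift_def using assms word_eval_closed[OF f]
  by (intro add.finprod_mono_neutral_cong_left) (auto simp: in_keys_iff)

lemma free_assoc_lift_closed: "p \<in> carrier (free_assoc X) \<Longrightarrow> free_assoc_lift A f p \<in> carrier A"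
  unfolding free_assoc_lift_def using word_eval_closed[OF f] by (intro finsum_closed) auto

lemma free_assoc_lift_add:
  assumes "p \<in> carrier (free_assoc X)" "q \<in> carrier (free_assoc X)"
  shows "free_assoc_lift A f (p + q) = free_assoc_lift A f p \<oplus> free_assoc_lift A f q"
proof -
  let ?S = "Poly_Mapping.keys p \<union> Poly_Mapping.keys q"
  have S: "set (letters w) \<subseteq> X" if "w \<in> ?S" for w using assms that by auto
  have "free_assoc_lift A f (p + q) =
      (\<Oplus>w\<in>?S. Poly_Mapping.lookup (p + q) w \<odot> word_eval A f (letters w))"
    using S keys_add[of p q] by (intro free_assoc_lift_superset) auto
  also have "\<dots> = (\<Oplus>w\<in>?S. Poly_Mapping.lookup p w \<odot> word_eval A f (letters w) \<oplus>
      Poly_Mapping.lookup q w \<odot> word_eval A f (letters w))"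
    using word_eval_closed[OF f S] by (intro finsum_cong') (auto simp: lookup_add smult_l_distr)
  also have "\<dots> = (\<Oplus>w\<in>?S. Poly_Mapping.lookup p w \<odot> word_eval A f (letters w)) \<oplus>
      (\<Oplus>w\<in>?S. Poly_Mapping.lookup q w \<odot> word_eval A f (letters w))"
    using word_eval_closed[OF f S] by (intro finsum_addf) auto
  also have "\<dots> = free_assoc_lift A f p \<oplus> free_assoc_lift A f q"
    using S by (subst (1 2) free_assoc_lift_superset[of ?S]) auto
  finally show ?thesis .
qed

lemma free_assoc_lift_single:
  assumes "set (letters w) \<subseteq> X"
  shows "free_assoc_lift A f (Poly_Mapping.single w c) = c \<odot> word_eval A f (letters w)"
  using assms word_eval_closed[OF f] by (subst free_assoc_lift_superset[of "{w}"]) auto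

lemma free_assoc_lift_zero: "free_assoc_lift A f 0 = \<zero>"
  by (simp add: free_assoc_lift_def)

lemma free_assoc_lift_scale:
  assumes "p \<in> carrier (free_assoc X)"
  shows "free_assoc_lift A f (Poly_Mapping.map ((*) s) p) = s \<odot> free_assoc_lift A f p"
proof -
  have "Poly_Mapping.keys p \<subseteq> {w. w \<noteq> 0 \<and> set (letters w) \<subseteq> X}" using assms by auto
  then show ?thesis
  proof (induction rule: poly_mapping_span_induct)
    case zero then show ?case by (simp add: mult_map_scale_conv_mult free_assoc_lift_zero)
  next
    case (single w c) then show ?case
      using word_eval_closed[OF f]
      by (simp add: free_assoc_lift_single smult_assoc1 mult_map_scale_conv_mult mult_single)
  next
    case (add p q)
    then have "p \<in> carrier (free_assoc X)" "q \<in> carrier (free_assoc X)" by auto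
    moreover have scale_add: "Poly_Mapping.map ((*) s) (p + q) = Poly_Mapping.map ((*) s) p + Poly_Mapping.map ((*) s) q"
      by (simp add: mult_map_scale_conv_mult distrib_left)
    ultimately show ?case
      using add free_assoc.smult_closed[of p X s] free_assoc.smult_closed[of q X s]
        free_assoc_lift_closed[of p] free_assoc_lift_closed[of q]
        free_assoc_lift_add[of "Poly_Mapping.map ((*) s) p" "Poly_Mapping.map ((*) s) q"]
      by (simp add: free_assoc_lift_add smult_r_distr scale_add del: free_assoc_simps(1))
  qed
qed

lemma free_assoc_lift_mult:
  assumes p: "p \<in> carrier (free_assoc X)" and q: "q \<in> carrier (free_assoc X)"
  shows "free_assoc_lift A f (p * q) = free_assoc_lift A f p \<otimes> free_assoc_lift A f q"
proof -
  let ?W = "{w. w \<noteq> 0 \<and> set (letters w) \<subseteq> X}"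
  have carr: "p \<in> carrier (free_assoc X)" if "Poly_Mapping.keys p \<subseteq> ?W" for p :: "'x word \<Rightarrow>\<^sub>0 'k" 
    using that by auto
  note closed = free_assoc_lift_closed[OF carr] 
  have mult_carr: "p * q \<in> carrier (free_assoc X)" 
    if "Poly_Mapping.keys p \<subseteq> ?W" "Poly_Mapping.keys q \<subseteq> ?W" for p q :: "'x word \<Rightarrow>\<^sub>0 'k" 
    using free_assoc.m_closed[OF carr carr, OF that] by simp
  have W: "Poly_Mapping.keys p \<subseteq> ?W" "Poly_Mapping.keys q \<subseteq> ?W" using p q by auto
  have single_mult: "free_assoc_lift A f (Poly_Mapping.single u c * q) =
      free_assoc_lift A f (Poly_Mapping.single u c) \<otimes> free_assoc_lift A f q" if u: "u \<in> ?W" for u c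
    using W(2)
  proof (induction rule: poly_mapping_span_induct)
    case zero show ?case using closed[of "Poly_Mapping.single u c"] u by (simp add: free_assoc_lift_zero)
  next
    case (single v d)
    have "letters u \<noteq> []" "letters v \<noteq> []" using u single by (cases u; cases v; simp add: zero_word_def)+
    moreover have "set (letters (u + v)) \<subseteq> X" using u single by (simp add: plus_word_def)
    ultimately show ?case using u single word_eval_closed[OF f, of "letters u"] word_eval_closed[OF f, of "letters v"]
      by (simp add: mult_single free_assoc_lift_single)
        (simp add: plus_word_def word_eval_append[OF f] smult_assoc2 smult_assoc3 mult.commute
          flip: smult_assoc1)
  next
    case (add q r)
    have s: "Poly_Mapping.keys (Poly_Mapping.single u c) \<subseteq> ?W" using u by simp
    show ?case using add.IH
      by (simp add: distrib_left free_assoc_lift_add[OF mult_carr[OF s add.hyps(1)] mult_carr[OF s add.hyps(2)]]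
          free_assoc_lift_add[OF carr carr, OF add.hyps]
          r_distr[OF closed closed closed, OF add.hyps s])
  qed
  show ?thesis using W(1)
  proof (induction rule: poly_mapping_span_induct)
    case zero show ?case using closed[OF W(2)] by (simp add: free_assoc_lift_zero)
  next
    case (single u c) then show ?case by (rule single_mult)
  next
    case (add p r)
    show ?case using add.IH
      by (simp add: distrib_right free_assoc_lift_add[OF mult_carr mult_carr, OF add.hyps(1) W(2) add.hyps(2) W(2)]
          free_assoc_lift_add[OF carr carr, OF add.hyps]
          l_distr[OF closed closed closed, OF add.hyps W(2)])
  qed
qed

lemma free_assoc_lift_hom: "free_assoc_lift A f \<in> algebra_hom (free_assoc X) A"
  using free_assoc_lift_closed free_assoc_lift_add free_assoc_lift_mult free_assoc_lift_scale
  by (simp add: algebra_hom_def Pi_iff del: free_assoc_simps(1))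

end

end

lemma algebra_homD:
  assumes "h \<in> algebra_hom A B"
  shows "x \<in> carrier A \<Longrightarrow> h x \<in> carrier B"
    "x \<in> carrier A \<Longrightarrow> y \<in> carrier A \<Longrightarrow> h (x \<oplus>\<^bsub>A\<^esub> y) = h x \<oplus>\<^bsub>B\<^esub> h y"
    "x \<in> carrier A \<Longrightarrow> y \<in> carrier A \<Longrightarrow> h (x \<otimes>\<^bsub>A\<^esub> y) = h x \<otimes>\<^bsub>B\<^esub> h y"
    "x \<in> carrier A \<Longrightarrow> h (s \<odot>\<^bsub>A\<^esub> x) = s \<odot>\<^bsub>B\<^esub> h x"
  using assms by (auto simp: algebra_hom_def)

lemma algebra_hom_zero:
  assumes "h \<in> algebra_hom A B" "nonunital_algebra A" "nonunital_algebra B"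
  shows "h \<zero>\<^bsub>A\<^esub> = \<zero>\<^bsub>B\<^esub>"
proof -
  interpret A: nonunital_algebra A by fact
  interpret B: nonunital_algebra B by fact
  have "h (0 \<odot>\<^bsub>A\<^esub> \<zero>\<^bsub>A\<^esub>) = 0 \<odot>\<^bsub>B\<^esub> h \<zero>\<^bsub>A\<^esub>" using assms(1) A.zero_closed by (rule algebra_homD)
  then show ?thesis using algebra_homD(1)[OF assms(1) A.zero_closed] by simp
qed

lemma algebra_hom_first_type_poly:
  assumes "h \<in> algebra_hom A B" "nonunital_algebra A" "a \<in> carrier A" "b \<in> carrier A" "c \<in> carrier A"
  shows "h (first_type_poly A a b c) = first_type_poly B (h a) (h b) (h c)"
proof -
  interpret A: nonunital_algebra A by fact
  show ?thesis using assms(3-) by (simp add: first_type_poly_def algebra_homD[OF assms(1)])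
qed

lemma algebra_hom_kernel_ideal:
  assumes h: "h \<in> algebra_hom A B" and A: "nonunital_algebra A" and B: "nonunital_algebra B"
  shows "algebra_ideal A {x \<in> carrier A. h x = \<zero>\<^bsub>B\<^esub>}"
proof -
  interpret A: nonunital_algebra A by fact
  interpret B: nonunital_algebra B by fact
  show ?thesis
    by (intro algebra_ideal.intro algebra_ideal_axioms.intro A.additive_subgroup_smultI A)
      (auto simp: algebra_homD[OF h] algebra_hom_zero[OF h A B])
qed

subsection \<open>The free algebra of the variety\<close>

lemma first_type_ideal: "algebra_ideal (free_assoc X) (first_type_ideal X)"
  unfolding first_type_ideal_def using free_assoc.first_type_poly_closed
  by (intro free_assoc.algebra_genideal_ideal) blast

interpretation first_type_ideal: algebra_ideal "free_assoc X :: ('k::field, _) module" "first_type_ideal X" for X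
  by (rule first_type_ideal)

theorem free_first_type_algebra:
  "first_type_algebra (free_first_type X :: ('k::field, _) module)"
proof (intro first_type_algebra.intro first_type_algebra_axioms.intro)
  show "nonunital_algebra (free_first_type X :: ('k, _) module)"
    unfolding free_first_type_def by (rule first_type_ideal.quot_nonunital_algebra)
  fix a b c assume abc: "a \<in> carrier (free_first_type X :: ('k, _) module)"
    "b \<in> carrier (free_first_type X :: ('k, _) module)" "c \<in> carrier (free_first_type X :: ('k, _) module)"
  obtain a' b' c' where *: "a' \<in> carrier (free_assoc X)" "b' \<in> carrier (free_assoc X)" "c' \<in> carrier (free_assoc X)"
    "a = first_type_ideal X +>\<^bsub>free_assoc X :: ('k, _) module\<^esub> a'"
    "b = first_type_ideal X +>\<^bsub>free_assoc X :: ('k, _) module\<^esub> b'"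
    "c = first_type_ideal X +>\<^bsub>free_assoc X :: ('k, _) module\<^esub> c'"
    using abc[unfolded free_first_type_def algebra_quot_simps] by (elim first_type_ideal.quot_carrierE)
  have "first_type_poly (free_assoc X) a' b' c' \<in> first_type_ideal X"
    unfolding first_type_ideal_def by (rule subsetD[OF algebra_genideal_self]) (use *(1-3) in blast)
  then show "first_type_poly (free_first_type X) a b c = \<zero>\<^bsub>free_first_type X\<^esub>"
    using *(1-3) by (simp add: free_first_type_def * first_type_ideal.quot_first_type_poly
        first_type_ideal.coset_eq_I del: free_assoc_simps(1))
qed

lemma free_first_type_gen_carrier: "x \<in> X \<Longrightarrow> free_first_type_gen X x \<in> carrier (free_first_type X)"
  unfolding free_first_type_gen_def free_first_type_def algebra_quot_simps
  by (intro first_type_ideal.quot_carrierI) (simp add: zero_word_def)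

theorem free_first_type_universal:
  fixes B :: "('k::field, 'b) module"
  assumes "first_type_algebra B" and f: "f \<in> X \<rightarrow> carrier B"
  shows "\<exists>h \<in> algebra_hom (free_first_type X) B. \<forall>x\<in>X. h (free_first_type_gen X x) = f x"
    and "\<lbrakk>h \<in> algebra_hom (free_first_type X) B; h' \<in> algebra_hom (free_first_type X) B;
      \<forall>x\<in>X. h (free_first_type_gen X x) = h' (free_first_type_gen X x); a \<in> carrier (free_first_type X)\<rbrakk>
      \<Longrightarrow> h a = h' a"
proof -
  interpret B: first_type_algebra B by fact
  let ?F = "free_assoc X :: ('k, _) module" and ?I = "first_type_ideal X :: (_ \<Rightarrow>\<^sub>0 'k) set"
  let ?cos = "\<lambda>p. ?I +>\<^bsub>?F\<^esub> p"
  define g where "g = free_assoc_lift B f"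
  have g: "g \<in> algebra_hom ?F B" unfolding g_def by (rule B.free_assoc_lift_hom[OF f])
  have "?I \<subseteq> {p \<in> carrier ?F. g p = \<zero>\<^bsub>B\<^esub>}"
    unfolding first_type_ideal_def
  proof (rule algebra_genideal_minimal)
    show "algebra_ideal ?F {p \<in> carrier ?F. g p = \<zero>\<^bsub>B\<^esub>}"
      by (rule algebra_hom_kernel_ideal[OF g free_assoc_nonunital_algebra B.nonunital_algebra_axioms])
    show "{first_type_poly ?F a b c |a b c. a \<in> carrier ?F \<and> b \<in> carrier ?F \<and> c \<in> carrier ?F}
        \<subseteq> {p \<in> carrier ?F. g p = \<zero>\<^bsub>B\<^esub>}"
      using free_assoc.first_type_poly_closed B.first_type algebra_homD(1)[OF g]
        algebra_hom_first_type_poly[OF g free_assoc_nonunital_algebra]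
      by (auto simp del: free_assoc_simps)
  qed
  then have kernel: "g i = \<zero>\<^bsub>B\<^esub>" if "i \<in> ?I" for i using that by blast
  define h where "h C = the_elem (g ` C)" for C
  have h: "h (?cos p) = g p" if p: "p \<in> carrier ?F" for p
  proof -
    have "g q = g p" if q: "q \<in> ?cos p" for q
    proof -
      obtain i where "i \<in> ?I" "q = i \<oplus>\<^bsub>?F\<^esub> p" using q unfolding first_type_ideal.coset_elem by (rule bexE)
      then show ?thesis
        using p by (simp only: algebra_homD[OF g] first_type_ideal.a_Hcarr kernel B.l_zero)
    qed
    moreover have "p \<in> ?cos p" using p by (rule first_type_ideal.a_rcos_self)
    ultimately have "g ` ?cos p = {g p}" by blast
    then show ?thesis by (simp add: h_def)
  qed
  have "h \<in> algebra_hom (free_first_type X) B"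
    unfolding algebra_hom_def free_first_type_def algebra_quot_simps
  proof (intro CollectI conjI ballI allI Pi_I, goal_cases)
    case (1 C) then show ?case
      by (elim first_type_ideal.quot_carrierE) (simp add: h algebra_homD[OF g] del: free_assoc_simps)
  next
    case (2 C D) then show ?case
      by (elim first_type_ideal.quot_carrierE)
        (simp add: h algebra_homD[OF g] first_type_ideal.a_rcos_sum del: free_assoc_simps)
  next
    case (3 C D) then show ?case
      by (elim first_type_ideal.quot_carrierE)
        (simp add: h algebra_homD[OF g] first_type_ideal.quot_mult del: free_assoc_simps)
  next
    case (4 s C) then show ?case
      by (elim first_type_ideal.quot_carrierE)
        (simp only: h algebra_homD[OF g] first_type_ideal.quot_smult free_assoc.smult_closed)
  qed
  moreover have "h (free_first_type_gen X x) = f x" if x: "x \<in> X" for x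
  proof -
    have "Poly_Mapping.single (Word [x]) 1 \<in> carrier ?F" using x by (simp add: zero_word_def)
    then have "h (free_first_type_gen X x) = g (Poly_Mapping.single (Word [x]) 1)"
      by (simp only: h free_first_type_gen_def)
    also have "\<dots> = f x" using x f by (simp add: g_def B.free_assoc_lift_single[OF f] B.smult_one[OF funcset_mem[OF f]])
    finally show ?thesis .
  qed
  ultimately show "\<exists>h \<in> algebra_hom (free_first_type X) B. \<forall>x\<in>X. h (free_first_type_gen X x) = f x"
    by blast
next
  assume h: "h \<in> algebra_hom (free_first_type X) B" and h': "h' \<in> algebra_hom (free_first_type X) B"
    and eq: "\<forall>x\<in>X. h (free_first_type_gen X x) = h' (free_first_type_gen X x)"
    and a: "a \<in> carrier (free_first_type X)"
  interpret B: first_type_algebra B by fact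
  interpret Q: first_type_algebra "free_first_type X :: ('k, _) module" by (rule free_first_type_algebra)
  let ?F = "free_assoc X :: ('k, _) module" and ?I = "first_type_ideal X :: (_ \<Rightarrow>\<^sub>0 'k) set"
  let ?Q = "free_first_type X :: ('k, _) module"
  let ?cos = "\<lambda>p. ?I +>\<^bsub>?F\<^esub> p"
  let ?W = "{w. w \<noteq> 0 \<and> set (letters w) \<subseteq> X}"
  have cos: "?cos p \<in> carrier ?Q" if "p \<in> carrier ?F" for p
    using that first_type_ideal.quot_carrierI by (simp add: free_first_type_def del: free_assoc_simps)
  have word: "h (?cos (Poly_Mapping.single (Word us) 1)) = h' (?cos (Poly_Mapping.single (Word us) 1))"
    if "set us \<subseteq> X" "us \<noteq> []" for us
    using that
  proof (induction us rule: induct_list012)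
    case (2 x) then show ?case using eq by (simp add: free_first_type_gen_def)
  next
    case (3 x y zs)
    let ?p = "Poly_Mapping.single (Word [x]) (1::'k)" and ?q = "Poly_Mapping.single (Word (y # zs)) (1::'k)"
    have pq: "?p \<in> carrier ?F" "?q \<in> carrier ?F" using 3 by (auto simp: zero_word_def)
    have "Poly_Mapping.single (Word (x # y # zs)) 1 = ?p \<otimes>\<^bsub>?F\<^esub> ?q"
      by (simp add: mult_single plus_word_def)
    then have *: "?cos (Poly_Mapping.single (Word (x # y # zs)) 1) = ?cos ?p \<otimes>\<^bsub>?Q\<^esub> ?cos ?q"
      using first_type_ideal.quot_mult[OF pq] by (simp only: free_first_type_def algebra_quot_simps)
    have "h (?cos ?p) = h' (?cos ?p)" using eq 3 by (simp add: free_first_type_gen_def)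
    moreover have "h (?cos ?q) = h' (?cos ?q)" using 3 by simp
    ultimately show ?case
      unfolding * by (simp only: algebra_homD(3)[OF h cos cos, OF pq] algebra_homD(3)[OF h' cos cos, OF pq])
  qed simp
  obtain p where p: "p \<in> carrier ?F" "a = ?cos p"
    using a unfolding free_first_type_def algebra_quot_simps by (elim first_type_ideal.quot_carrierE)
  have "Poly_Mapping.keys p \<subseteq> ?W" using p by auto
  then have "h (?cos p) = h' (?cos p)"
  proof (induction rule: poly_mapping_span_induct)
    case zero
    have "?cos 0 = \<zero>\<^bsub>?Q\<^esub>" using first_type_ideal.coset_I by (simp add: free_first_type_def)
    then show ?case
      using algebra_hom_zero[OF h Q.nonunital_algebra_axioms B.nonunital_algebra_axioms]
        algebra_hom_zero[OF h' Q.nonunital_algebra_axioms B.nonunital_algebra_axioms] by simp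
  next
    case (single w c)
    let ?p = "Poly_Mapping.single w (1::'k)"
    have p: "?p \<in> carrier ?F" using single by simp
    have "Poly_Mapping.single w c = c \<odot>\<^bsub>?F\<^esub> ?p" by (simp add: mult_map_scale_conv_mult mult_single)
    then have *: "?cos (Poly_Mapping.single w c) = c \<odot>\<^bsub>?Q\<^esub> ?cos ?p"
      using first_type_ideal.quot_smult[OF p] by (simp only: free_first_type_def algebra_quot_simps)
    have "h (?cos ?p) = h' (?cos ?p)" using word[of "letters w"] single by (cases w) (simp add: zero_word_def)
    then show ?case
      unfolding * by (simp only: algebra_homD(4)[OF h cos, OF p] algebra_homD(4)[OF h' cos, OF p])
  next
    case (add p q)
    have pq: "p \<in> carrier ?F" "q \<in> carrier ?F" using add by auto
    have *: "?cos (p + q) = ?cos p \<oplus>\<^bsub>?Q\<^esub> ?cos q"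
      using first_type_ideal.a_rcos_sum[OF pq] by (simp add: free_first_type_def)
    show ?case
      unfolding * using add.IH
      by (simp only: algebra_homD(2)[OF h cos cos, OF pq] algebra_homD(2)[OF h' cos cos, OF pq])
  qed
  then show "h a = h' a" by (simp only: p)
qed

end

theory Submission
  imports Defs
begin

text \<open>
  Write \<open>S(x, y, z)\<close> for the symmetrised product that the identity of the variety annihilates.

  The anti-commutator obeys the Jacobi identity, since the cyclic sum of \<open>{{x, y}, z}\<close> is
  \<open>2 S(x, y, z)\<close>. With \<open>u = {a, b}\<close> it turns \<open>{{u, c}, d} + {{u, d}, c}\<close> into \<open>- {{c, d}, u}\<close>, so
  the claim is equivalent to \<open>{{{c, d}, {a, b}}, e} = 0\<close>.

  For any \<open>s\<close> and \<open>t\<close> one has \<open>{{s, t}, e} = S(s, t, e) - s e t - t e s\<close>. The claim therefore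
  follows once \<open>s e t = 0\<close> whenever \<open>s\<close> and \<open>t\<close> are anti-commutators. This is the linearised form of
  \<open>x\<^sup>2 z y\<^sup>2 = 0\<close>, the step on which Higman's proof of the Nagata--Higman theorem rests: in a nil
  algebra of index \<open>n\<close> the sum of \<open>x\<^sup>n\<^sup>-\<^sup>1\<^sup>-\<^sup>i z y\<^sup>j x\<^sup>i y\<^sup>n\<^sup>-\<^sup>1\<^sup>-\<^sup>j\<close> over \<open>0 \<le> i, j < n\<close>
  vanishes when it is summed over \<open>i\<close> first, because \<open>z y\<^sup>j\<close> sits among the powers of \<open>x\<close>. Summed over
  \<open>j\<close> first it vanishes for \<open>i > 0\<close>, because \<open>x\<^sup>i\<close> sits among the powers of \<open>y\<close>, and \<open>i = 0\<close> contributes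
  \<open>n x\<^sup>n\<^sup>-\<^sup>1 z y\<^sup>n\<^sup>-\<^sup>1\<close>. Here \<open>n = 3\<close>, and the division by 3 is where the characteristic enters.
\<close>

definition anticomm :: "('k, 'a) module \<Rightarrow> 'a \<Rightarrow> 'a \<Rightarrow> 'a" where
  "anticomm A x y = x \<otimes>\<^bsub>A\<^esub> y \<oplus>\<^bsub>A\<^esub> y \<otimes>\<^bsub>A\<^esub> x"

lemma (in nonunital_algebra) anticomm_closed [simp]:
  "\<lbrakk>x \<in> carrier A; y \<in> carrier A\<rbrakk> \<Longrightarrow> anticomm A x y \<in> carrier A"
  by (simp add: anticomm_def)

text \<open>
  The linearised double sum. The left-hand side is the sum evaluated with \<open>j\<close> fixed (\<open>j = 2, 1, 0\<close>,
  where \<open>j = 1\<close> splits into two terms by linearisation). The right-hand side is the same sum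
  evaluated with \<open>i\<close> fixed, where \<open>i = 0\<close> contributes the three equal summands. In the variety
  every \<open>first_type_poly\<close> is zero, so that only those summands remain.
\<close>

lemma (in nonunital_algebra) higman_double_sum:
  assumes [simp]: "a \<in> carrier A" "b \<in> carrier A" "c \<in> carrier A" "d \<in> carrier A" "e \<in> carrier A"
  defines "s \<equiv> anticomm A a b" and "t \<equiv> anticomm A c d"
  shows "first_type_poly A a b (e \<otimes> t)
      \<oplus> (first_type_poly A a b (e \<otimes> c) \<otimes> d \<oplus> first_type_poly A a b (e \<otimes> d) \<otimes> c)
      \<oplus> first_type_poly A a b e \<otimes> t
    = (s \<otimes> e \<otimes> t \<oplus> s \<otimes> e \<otimes> t \<oplus> s \<otimes> e \<otimes> t)
      \<oplus> (a \<otimes> e \<otimes> first_type_poly A c d b \<oplus> b \<otimes> e \<otimes> first_type_poly A c d a)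
      \<oplus> e \<otimes> first_type_poly A c d s"
  by (simp add: s_def t_def anticomm_def first_type_poly_def l_distr r_distr m_assoc a_ac)

context first_type_algebra
begin

lemma anticomm_sandwich_zero:
  assumes [simp]: "a \<in> carrier A" "b \<in> carrier A" "c \<in> carrier A" "d \<in> carrier A" "e \<in> carrier A"
    and char: "(3::'b) \<noteq> 0"
  shows "anticomm A a b \<otimes> e \<otimes> anticomm A c d = \<zero>"
proof -
  let ?m = "anticomm A a b \<otimes> e \<otimes> anticomm A c d"
  have "?m \<oplus> ?m \<oplus> ?m = \<zero>"
    using higman_double_sum[of a b c d e] by (simp add: first_type)
  moreover have "(1 + 1 + 1 :: 'b) \<odot> ?m = ?m \<oplus> ?m \<oplus> ?m"
    by (simp only: smult_l_distr smult_one m_closed anticomm_closed assms)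
  ultimately have "(3::'b) \<odot> ?m = \<zero>"
    by simp
  then have "(inverse 3 * 3 :: 'b) \<odot> ?m = \<zero>"
    by (simp only: smult_assoc1 smult_zero m_closed anticomm_closed assms)
  then show ?thesis
    using char by simp
qed

lemma anticomm_jacobi:
  assumes [simp]: "x \<in> carrier A" "y \<in> carrier A" "z \<in> carrier A"
  shows "anticomm A (anticomm A x y) z \<oplus> anticomm A (anticomm A x z) y
    \<oplus> anticomm A (anticomm A y z) x = \<zero>"
proof -
  have "anticomm A (anticomm A x y) z \<oplus> anticomm A (anticomm A x z) y
      \<oplus> anticomm A (anticomm A y z) x = first_type_poly A x y z \<oplus> first_type_poly A x y z"
    by (simp add: anticomm_def first_type_poly_def l_distr r_distr m_assoc a_ac)
  then show ?thesis
    by (simp add: first_type)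
qed

lemma anticomm_anticomm_zero:
  assumes [simp]: "s \<in> carrier A" "t \<in> carrier A" "e \<in> carrier A"
    and "s \<otimes> e \<otimes> t = \<zero>" "t \<otimes> e \<otimes> s = \<zero>"
  shows "anticomm A (anticomm A s t) e = \<zero>"
proof -
  have "anticomm A (anticomm A s t) e \<oplus> (s \<otimes> e \<otimes> t \<oplus> t \<otimes> e \<otimes> s) = first_type_poly A s t e"
    by (simp add: anticomm_def first_type_poly_def l_distr r_distr m_assoc a_ac)
  then show ?thesis
    by (simp add: assms(4,5) first_type)
qed

lemma anticomm_degree_five:
  assumes [simp]: "a \<in> carrier A" "b \<in> carrier A" "c \<in> carrier A" "d \<in> carrier A" "e \<in> carrier A"
    and char: "(3::'b) \<noteq> 0"
  shows "anticomm A (anticomm A (anticomm A (anticomm A a b) c) d) e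
    \<oplus> anticomm A (anticomm A (anticomm A (anticomm A a b) d) c) e = \<zero>"
proof -
  define u where "u = anticomm A a b"
  have [simp]: "u \<in> carrier A"
    by (simp add: u_def)
  have add: "anticomm A (x \<oplus> y) e = anticomm A x e \<oplus> anticomm A y e"
    if "x \<in> carrier A" "y \<in> carrier A" for x y
    using that by (simp add: anticomm_def l_distr r_distr a_ac)
  have "anticomm A (anticomm A (anticomm A c d) u) e = \<zero>"
    by (rule anticomm_anticomm_zero) (simp_all add: u_def anticomm_sandwich_zero char)
  then have "anticomm A (anticomm A (anticomm A u c) d) e \<oplus> anticomm A (anticomm A (anticomm A u d) c) e
    = anticomm A (anticomm A (anticomm A u c) d \<oplus> anticomm A (anticomm A u d) c
        \<oplus> anticomm A (anticomm A c d) u) e"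
    by (simp add: add)
  also have "\<dots> = anticomm A \<zero> e"
    by (simp add: anticomm_jacobi)
  also have "\<dots> = \<zero>"
    by (simp add: anticomm_def)
  finally show ?thesis
    by (simp only: u_def)
qed

end

theorem theorem4:
  fixes X :: "'x set" and a b c d e :: "('x word \<Rightarrow>\<^sub>0 'k::field_char_0) set"
  defines "P \<equiv> plus_algebra (free_first_type X)"
  assumes "a \<in> carrier P" "b \<in> carrier P" "c \<in> carrier P" "d \<in> carrier P" "e \<in> carrier P"
  shows "(((a \<otimes>\<^bsub>P\<^esub> b) \<otimes>\<^bsub>P\<^esub> c) \<otimes>\<^bsub>P\<^esub> d) \<otimes>\<^bsub>P\<^esub> e \<oplus>\<^bsub>P\<^esub> (((a \<otimes>\<^bsub>P\<^esub> b) \<otimes>\<^bsub>P\<^esub> d) \<otimes>\<^bsub>P\<^esub> c) \<otimes>\<^bsub>P\<^esub> e = \<zero>\<^bsub>P\<^esub>"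
proof -
  interpret F: first_type_algebra "free_first_type X :: ('k, _) module"
    by (rule free_first_type_algebra)
  have P: "carrier P = carrier (free_first_type X)" "mult P = anticomm (free_first_type X)"
    "add P = add (free_first_type X)" "zero P = zero (free_first_type X)"
    by (simp_all add: P_def plus_algebra_def anticomm_def fun_eq_iff)
  show ?thesis
    using F.anticomm_degree_five[of a b c d e] assms(2-) by (simp add: P)
qed

end
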